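(* If a finite simple graph $G$ contains an induced cycle of length at least four, then $\dim_{\mathrm{poc}}(G)\ge 3$.
   Context: For $\mathbf{x},\mathbf{y}\in\mathbb{R}^d$, $\mathbf{x}\prec\mathbf{y}$ means $x_i<y_i$ for all $i$. For finite $S\subseteq\mathbb{R}^d$, $D_S$ is the digraph on $S$ with an arc $(\mathbf{x},\mathbf{v})$ whenever $\mathbf{v}\prec\mathbf{x}$; by convention $\mathbb{R}^0$ is a single point, so a $0$-dimensional $D_S$ has at most one vertex. The competition graph $C(D)$ of a digraph $D$ has vertex set $V(D)$ and an edge between distinct $x,y$ iff some $z$ has arcs $(x,z),(y,z)$. The partial order competition dimension $\dim_{\mathrm{poc}}(G)$ of a graph $G$ is the smallest nonnegative integer $d$ such that for some nonnegative integer $k$ and some finite $S\subseteq\mathbb{R}^d$, the disjoint union of $G$ and $k$ isolated vertices is isomorphic to $C(D_S)$. *)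

theory Defs
  imports Complex_Main "HOL-Library.FuncSet" "Graph_Theory.Graph_Theory"
begin

text \<open>
  A finite simple graph is an instance of the locale \<^locale>\<open>pair_graph\<close>: a finite, loop-free,
  symmetric digraph whose arcs are ordered pairs of vertices, so that an undirected edge
  \<open>{x, y}\<close> appears as the two arcs \<open>(x, y)\<close> and \<open>(y, x)\<close>.  Since both arcs are always present,
  \<^const>\<open>digraph_iso\<close> and \<^const>\<open>induced_subgraph\<close> restrict to the usual notions for graphs.
\<close>

text \<open>
  The dimension varies, so the points are extensional functions on \<open>{..<d}\<close>; in particular
  \<open>euclidean_points 0\<close> is the singleton \<open>{\<lambda>_. undefined}\<close>.
\<close>

definition euclidean_points :: "nat \<Rightarrow> (nat \<Rightarrow> real) set" where
  "euclidean_points d = {..<d} \<rightarrow>\<^sub>E UNIV"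

definition strictly_below :: "nat \<Rightarrow> (nat \<Rightarrow> real) \<Rightarrow> (nat \<Rightarrow> real) \<Rightarrow> bool" where
  "strictly_below d x y \<longleftrightarrow> (\<forall>i<d. x i < y i)"

text \<open>
  For \<open>d = 0\<close> the relation \<open>strictly_below 0\<close> holds vacuously, so the only possible vertex
  carries a loop.  This has no effect on the competition graph, whose edges join distinct vertices.
\<close>

definition poc_digraph :: "nat \<Rightarrow> (nat \<Rightarrow> real) set \<Rightarrow> (nat \<Rightarrow> real) pair_pre_digraph" where
  "poc_digraph d S =
    \<lparr> pverts = S, parcs = {(x, v). x \<in> S \<and> v \<in> S \<and> strictly_below d v x} \<rparr>"

definition competition_graph :: "('a, 'b) pre_digraph \<Rightarrow> 'a pair_pre_digraph" where
  "competition_graph D =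
    \<lparr> pverts = verts D,
      parcs = {(x, y). x \<in> verts D \<and> y \<in> verts D \<and> x \<noteq> y \<and>
                 (\<exists>z \<in> verts D. x \<rightarrow>\<^bsub>D\<^esub> z \<and> y \<rightarrow>\<^bsub>D\<^esub> z)} \<rparr>"

definition add_isolated :: "nat \<Rightarrow> 'a pair_pre_digraph \<Rightarrow> ('a + nat) pair_pre_digraph" where
  "add_isolated k G =
    \<lparr> pverts = Inl ` pverts G \<union> Inr ` {..<k}, parcs = map_prod Inl Inl ` parcs G \<rparr>"

text \<open>
  The minimum is attained for every finite simple graph \<open>G\<close>.  If \<open>G\<close> has \<open>n\<close> vertices and \<open>m\<close>
  edges, then \<open>d = n\<close> and \<open>k = m\<close> are possible: indexing coordinates by vertices, represent a
  vertex \<open>v\<close> by the point that is \<open>0\<close> at \<open>v\<close> and \<open>2\<close> elsewhere, and add for each edge \<open>e\<close>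
  the point that is \<open>-1\<close> on the ends of \<open>e\<close> and \<open>1\<close> elsewhere.
\<close>

definition dim_poc :: "'a pair_pre_digraph \<Rightarrow> nat" where
  "dim_poc G =
    (LEAST d. \<exists>k S. finite S \<and> S \<subseteq> euclidean_points d \<and>
       digraph_iso (add_isolated k G) (competition_graph (poc_digraph d S)))"

text \<open>The cycle on \<open>n\<close> vertices; meaningful for \<open>n \<ge> 3\<close>.\<close>

definition cycle_graph :: "nat \<Rightarrow> nat pair_pre_digraph" where
  "cycle_graph n =
    \<lparr> pverts = {..<n},
      parcs = {(i, j). i < n \<and> j < n \<and> (j = Suc i mod n \<or> i = Suc j mod n)} \<rparr>"

definition has_induced_cycle :: "'a pair_pre_digraph \<Rightarrow> nat \<Rightarrow> bool" where
  "has_induced_cycle G n \<longleftrightarrow>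
    (\<exists>H :: 'a pair_pre_digraph. induced_subgraph H G \<and> digraph_iso (cycle_graph n) H)"

end

theory Submission
  imports Defs
begin

text \<open>
  In a doubly partial order, a point with minimal first coordinate among its neighbours \<open>u\<close>, \<open>w\<close>
  forces \<open>u\<close> and \<open>w\<close> to be adjacent: either the two neighbours are comparable and the smaller one
  passes on its prey, or the common prey of the minimal point and one neighbour lies below the
  other neighbour, too.  So in dimension at most 2 the vertex of an induced cycle
  with minimal first coordinate has adjacent neighbours, and the cycle is a triangle.
\<close>

section \<open>Isomorphisms of pair digraphs as vertex maps\<close>

text \<open>Arcs of a pair digraph are determined by their ends, so the arc map is forced by the
  vertex map, and only the latter needs to be kept.\<close>

lemma digraph_iso_with_projE:
  fixes G :: "'a pair_pre_digraph" and H :: "'b pair_pre_digraph"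
  assumes "digraph_iso (with_proj G) (with_proj H)"
  obtains f where "inj_on f (pverts G)" "pverts H = f ` pverts G"
    "\<And>x y. x \<in> pverts G \<Longrightarrow> y \<in> pverts G \<Longrightarrow> (f x, f y) \<in> parcs H \<longleftrightarrow> (x, y) \<in> parcs G"
proof -
  from assms obtain i :: "('a, 'a \<times> 'a, 'b, 'b \<times> 'b) digraph_isomorphism"
    where i: "pre_digraph.digraph_isomorphism (with_proj G) i"
    and H: "with_proj H = app_iso i (with_proj G)"
    unfolding digraph_iso_def by blast
  \<comment> \<open>Comparing record fields shows that \<open>iso_tail i\<close> and
    \<open>iso_head i\<close> are the projections, so \<open>iso_arcs i\<close> acts on arcs
    componentwise through \<open>iso_verts i\<close>.\<close>
  have H': "pverts H = iso_verts i ` pverts G" "parcs H = iso_arcs i ` parcs G"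
    "iso_tail i = fst" "iso_head i = snd"
    using H by (simp_all add: with_proj_def app_iso_def)
  have inj: "inj_on (iso_verts i) (pverts G)"
    and wf: "wf_digraph (with_proj G)"
    and arcs: "\<And>a. a \<in> parcs G \<Longrightarrow>
      iso_arcs i a = (iso_verts i (fst a), iso_verts i (snd a))"
    using i H'(3,4) by (auto simp: pre_digraph.digraph_isomorphism_def prod_eq_iff)
  have ends: "fst a \<in> pverts G" "snd a \<in> pverts G" if "a \<in> parcs G" for a
    using wf_digraph.tail_in_verts[OF wf, of a] wf_digraph.head_in_verts[OF wf, of a] that
    by simp_all
  show thesis
  proof (rule that[OF inj H'(1)])
    fix x y assume xy: "x \<in> pverts G" "y \<in> pverts G"
    show "(iso_verts i x, iso_verts i y) \<in> parcs H \<longleftrightarrow> (x, y) \<in> parcs G"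
    proof
      assume "(iso_verts i x, iso_verts i y) \<in> parcs H"
      then obtain a where a: "a \<in> parcs G" "iso_arcs i a = (iso_verts i x, iso_verts i y)"
        using H'(2) by force
      with arcs[OF a(1)] ends[OF a(1)] xy have "a = (x, y)"
        by (simp add: prod_eq_iff inj_on_eq_iff[OF inj])
      with a show "(x, y) \<in> parcs G" by simp
    next
      assume "(x, y) \<in> parcs G"
      with arcs H'(2) show "(iso_verts i x, iso_verts i y) \<in> parcs H" by force
    qed
  qed
qed

lemma digraph_iso_with_projI:
  fixes G :: "'a pair_pre_digraph" and H :: "'b pair_pre_digraph"
  assumes "pair_wf_digraph G" "inj_on f (pverts G)" "pverts H = f ` pverts G"
    "parcs H = map_prod f f ` parcs G"
  shows "digraph_iso (with_proj G) (with_proj H)"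
proof -
  interpret pair_wf_digraph G by fact
  let ?i = "\<lparr>iso_verts = f, iso_arcs = map_prod f f, iso_head = snd, iso_tail = fst\<rparr>"
  \<comment> \<open>\<open>f\<close> is injective on vertices only; well-formedness carries this
    over to the pairs that are arcs.\<close>
  have "parcs G \<subseteq> pverts G \<times> pverts G"
    using wellformed' by auto
  then have "inj_on (map_prod f f) (parcs G)"
    using map_prod_inj_on[OF assms(2,2)] inj_on_subset by blast
  then have "pre_digraph.digraph_isomorphism (with_proj G) ?i"
    using assms(2) wf_digraph_axioms by (simp add: pre_digraph.digraph_isomorphism_def)
  moreover have "with_proj H = app_iso ?i (with_proj G)"
    using assms(3,4) by (simp add: with_proj_def app_iso_def)
  ultimately show ?thesis unfolding digraph_iso_def by blast
qed

section \<open>Existence of a representation\<close>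

lemma pair_wf_digraph_add_isolated:
  assumes "pair_wf_digraph G"
  shows "pair_wf_digraph (add_isolated k G)"
proof -
  interpret pair_wf_digraph G by fact
  show ?thesis
    by unfold_locales (auto simp: add_isolated_def dest: wellformed')
qed

lemma parcs_competition_poc:
  "(x, y) \<in> parcs (competition_graph (poc_digraph d S)) \<longleftrightarrow>
    x \<in> S \<and> y \<in> S \<and> x \<noteq> y \<and> (\<exists>z\<in>S. strictly_below d z x \<and> strictly_below d z y)"
  by (auto simp: competition_graph_def poc_digraph_def)

text \<open>
  One coordinate beyond those indexed by vertices, where every vertex has value 2 and every edge
  value 1, rules out all arcs other than those from vertices to edges.
\<close>

lemma ex_poc_representation:
  fixes G :: "'a pair_pre_digraph"
  assumes "pair_graph G"
  shows "\<exists>d k S. finite S \<and> S \<subseteq> euclidean_points d \<and>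
    digraph_iso (add_isolated k G) (competition_graph (poc_digraph d S))"
proof -
  interpret pair_graph G by fact
  have sym: "(v, u) \<in> parcs G" if "(u, v) \<in> parcs G" for u v
    using that pair_sym_arcs by (auto simp: symmetric_def sym_def)
  have loopfree: "u \<noteq> v" if "(u, v) \<in> parcs G" for u v
    using that pair_no_loops by fastforce
  define V where "V = pverts G"
  \<comment> \<open>Edges are unordered, so that both arcs of an edge yield the same prey
    point.\<close>
  define E where "E = (\<lambda>(u, v). {u, v}) ` parcs G"
  define n where "n = card V"
  have "finite V" "finite E"
    using pair_finite_verts pair_finite_arcs by (simp_all add: V_def E_def)
  have EV: "e \<subseteq> V" "e \<noteq> {}" if "e \<in> E" for e
    using that wellformed' by (auto simp: E_def V_def)
  \<comment> \<open>\<open>h\<close> turns vertices into coordinates below \<open>n\<close>;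
    coordinate \<open>n\<close> remains as the separating one.\<close>
  obtain h where h: "bij_betw h V {..<n}"
    using ex_bij_betw_finite_nat[OF \<open>finite V\<close>] by (auto simp: n_def atLeast0LessThan)
  have h_inj: "h u = h v \<longleftrightarrow> u = v" if "u \<in> V" "v \<in> V" for u v
    using h that by (auto simp: bij_betw_def dest: inj_onD)
  have h_less: "h v < n" if "v \<in> V" for v
    using h that by (auto simp: bij_betw_def)
  have h_image: "h v \<in> h ` e \<longleftrightarrow> v \<in> e" if "v \<in> V" "e \<in> E" for v e
    using h_inj EV(1) that by blast
  obtain g where g: "bij_betw g {..<card E} E"
    using ex_bij_betw_nat_finite[OF \<open>finite E\<close>] by (auto simp: atLeast0LessThan)
  define vpt :: "'a \<Rightarrow> nat \<Rightarrow> real"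
    where "vpt v = restrict (\<lambda>i. if i = h v then 0 else 2) {..<Suc n}" for v
  define ept :: "'a set \<Rightarrow> nat \<Rightarrow> real"
    where "ept e = restrict (\<lambda>i. if i \<in> h ` e then - 1 else 1) {..<Suc n}" for e
  have vpt_inj: "u = v" if "vpt u = vpt v" "u \<in> V" "v \<in> V" for u v
    using fun_cong[OF that(1), of "h u"] h_less[OF that(2)] h_inj that(2,3)
    by (auto simp: vpt_def split: if_splits)
  have ept_inj: "e = e'" if "ept e = ept e'" "e \<in> E" "e' \<in> E" for e e'
  proof -
    have "v \<in> e \<longleftrightarrow> v \<in> e'" if "v \<in> V" for v
      using fun_cong[OF \<open>ept e = ept e'\<close>, of "h v"] h_less[OF that] h_image that \<open>e \<in> E\<close> \<open>e' \<in> E\<close>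
      by (auto simp: ept_def split: if_splits)
    with EV(1) \<open>e \<in> E\<close> \<open>e' \<in> E\<close> show ?thesis by blast
  qed
  have last_vpt: "vpt v n = 2" if "v \<in> V" for v
    using h_less[OF that] by (simp add: vpt_def)
  have last_ept: "ept e n = 1" if "e \<in> E" for e
    using h_less EV(1)[OF that] by (fastforce simp: ept_def)
  have vpt_ept: "vpt v \<noteq> ept e" if "v \<in> V" "e \<in> E" for v e
    using last_vpt[OF that(1)] last_ept[OF that(2)] by auto
  \<comment> \<open>Away from \<open>h v\<close> the point \<open>vpt v\<close> has value 2 and
    exceeds every edge point. At \<open>h v\<close> it is 0, so the edge point must be -1 there,
    which marks the ends of the edge.\<close>
  have below_iff: "strictly_below (Suc n) (ept e) (vpt v) \<longleftrightarrow> v \<in> e" if "v \<in> V" "e \<in> E" for v e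
  proof
    assume "strictly_below (Suc n) (ept e) (vpt v)"
    then have "ept e (h v) < vpt v (h v)"
      using h_less[OF that(1)] by (simp add: strictly_below_def)
    then show "v \<in> e"
      using h_less[OF that(1)] h_image[OF that] by (auto simp: vpt_def ept_def split: if_splits)
  qed (auto simp: strictly_below_def vpt_def ept_def)
  have below_vpt: "\<not> strictly_below (Suc n) (vpt v) x"
    if "v \<in> V" "x \<in> vpt ` V \<union> ept ` E" for v x
  proof
    assume "strictly_below (Suc n) (vpt v) x"
    then have "vpt v n < x n" by (simp add: strictly_below_def)
    with that last_vpt last_ept show False by auto
  qed
  have below_ept: "\<not> strictly_below (Suc n) z (ept e)"
    if "e \<in> E" "z \<in> vpt ` V \<union> ept ` E" for e z
  proof
    assume "strictly_below (Suc n) z (ept e)"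
    then have "z n < ept e n" by (simp add: strictly_below_def)
    with that last_vpt last_ept show False by auto
  qed
  define S where "S = vpt ` V \<union> ept ` E"
  \<comment> \<open>The edge points, numbered by \<open>g\<close>, play the role of the isolated
    vertices.\<close>
  define f where "f = case_sum vpt (\<lambda>j. ept (g j))"
  let ?k = "card E" and ?C = "competition_graph (poc_digraph (Suc n) S)"
  have "finite S" using \<open>finite V\<close> \<open>finite E\<close> by (simp add: S_def)
  moreover have "S \<subseteq> euclidean_points (Suc n)"
    by (auto simp: S_def vpt_def ept_def euclidean_points_def PiE_def)
  moreover have "digraph_iso (add_isolated ?k G) ?C"
  proof (rule digraph_iso_with_projI)
    show "pair_wf_digraph (add_isolated ?k G)"
      by (intro pair_wf_digraph_add_isolated) unfold_locales
    have "ept (g j) \<noteq> vpt v" "vpt v \<noteq> ept (g j)" if "j < ?k" "v \<in> V" for j v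
      using vpt_ept[of v "g j"] bij_betwE[OF g] that by auto
    moreover have "i = j" if "ept (g i) = ept (g j)" "i < ?k" "j < ?k" for i j
      using ept_inj[OF that(1)] bij_betwE[OF g] bij_betw_imp_inj_on[OF g] that
      by (auto dest: inj_onD)
    ultimately show "inj_on f (pverts (add_isolated ?k G))"
      using vpt_inj by (auto simp: inj_on_def f_def add_isolated_def V_def)
    show "pverts ?C = f ` pverts (add_isolated ?k G)"
      using bij_betw_imp_surj_on[OF g]
      by (simp add: competition_graph_def poc_digraph_def add_isolated_def f_def S_def V_def
          image_Un image_image flip: image_image[of ept g])
    show "parcs ?C = map_prod f f ` parcs (add_isolated ?k G)"
    proof (intro equalityI subrelI)
      fix x y assume "(x, y) \<in> parcs ?C"
      then obtain z where xyz: "x \<in> S" "y \<in> S" "z \<in> S" "x \<noteq> y"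
        "strictly_below (Suc n) z x" "strictly_below (Suc n) z y"
        by (auto simp: parcs_competition_poc)
      \<comment> \<open>Vertex points are never prey and edge points never have prey, which fixes
        the kind of each of the three points.\<close>
      obtain u v e where uve: "x = vpt u" "y = vpt v" "z = ept e" "u \<in> V" "v \<in> V" "e \<in> E"
        using xyz below_vpt below_ept unfolding S_def by blast
      \<comment> \<open>Two distinct members exhaust the edge \<open>e\<close>, so it is
        \<open>{u, v}\<close>; as it may stem from either orientation, symmetry gives the
        arc.\<close>
      with xyz below_iff have "u \<in> e" "v \<in> e" "u \<noteq> v" by auto
      with \<open>e \<in> E\<close> sym have "(u, v) \<in> parcs G" by (auto simp: E_def)
      then show "(x, y) \<in> map_prod f f ` parcs (add_isolated ?k G)"
        using uve by (force simp: add_isolated_def f_def)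
    next
      fix x y assume "(x, y) \<in> map_prod f f ` parcs (add_isolated ?k G)"
      then obtain u v where uv: "(u, v) \<in> parcs G" "x = vpt u" "y = vpt v"
        by (auto simp: add_isolated_def f_def)
      then have "u \<in> V" "v \<in> V" "u \<noteq> v" "{u, v} \<in> E"
        using loopfree wellformed' by (force simp: V_def E_def)+
      with uv vpt_inj below_iff show "(x, y) \<in> parcs ?C"
        by (auto simp: parcs_competition_poc S_def intro!: bexI[of _ "ept {u, v}"])
    qed
  qed
  ultimately show ?thesis by blast
qed

section \<open>Competition in dimension at most 2\<close>

text \<open>Here \<open>u\<close> is the neighbour with the smaller first coordinate. If
  \<open>u\<close> lies below \<open>w\<close> in the weak order, its prey \<open>z'\<close> serves
  both; otherwise \<open>z\<close>, the common prey of \<open>a\<close> and \<open>w\<close>,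
  does.\<close>

lemma common_prey_of_neighbours:
  assumes "d \<le> 2" "z \<in> S" "z' \<in> S" "a 0 \<le> u 0" "u 0 \<le> w 0"
    and "strictly_below d z a" "strictly_below d z w" "strictly_below d z' u"
  shows "\<exists>y\<in>S. strictly_below d y u \<and> strictly_below d y w"
proof (cases "\<forall>i<d. u i \<le> w i")
  case True
  with assms(8) have "strictly_below d z' w"
    unfolding strictly_below_def by (meson less_le_trans)
  with assms show ?thesis by blast
next
  case False
  then obtain j where j: "j < d" "w j < u j" by (auto simp: not_le)
  \<comment> \<open>Coordinate 0 cannot witness incomparability, so dimensions 0 and 1 fall under
    the first case.\<close>
  with assms(5) have "j \<noteq> 0" by (metis not_le)
  with j(1) assms(1) have d: "d = 2" "j = 1" by simp_all
  \<comment> \<open>The bound on \<open>z\<close> comes from \<open>a\<close> in coordinate 0 and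
    from \<open>w\<close> in coordinate 1; \<open>u\<close> is at least as large in each.\<close>
  have "z 0 < a 0" "z 1 < w 1"
    using assms(6,7) d(1) by (simp_all add: strictly_below_def)
  with assms(4) j(2) d have "strictly_below d z u"
    by (simp add: strictly_below_def less_2_cases_iff)
  with assms show ?thesis by blast
qed

lemma simplicial_if_first_coordinate_minimal:
  assumes "d \<le> 2"
    and "(a, u) \<in> parcs (competition_graph (poc_digraph d S))"
    and "(a, w) \<in> parcs (competition_graph (poc_digraph d S))"
    and "a 0 \<le> u 0" "a 0 \<le> w 0" "u \<noteq> w"
  shows "(u, w) \<in> parcs (competition_graph (poc_digraph d S))"
proof -
  from assms obtain z z' where "u \<in> S" "w \<in> S" "z \<in> S" "z' \<in> S"
    "strictly_below d z a" "strictly_below d z u"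
    "strictly_below d z' a" "strictly_below d z' w"
    by (auto simp: parcs_competition_poc)
  \<comment> \<open>By linearity one neighbour has the smaller first coordinate; the two instances
    exchange \<open>u\<close> with \<open>w\<close> and \<open>z\<close> with
    \<open>z'\<close>.\<close>
  then show ?thesis
    using assms common_prey_of_neighbours[of d z' S z a u w]
      common_prey_of_neighbours[of d z S z' a w u]
    by (auto simp: parcs_competition_poc) (meson linear)
qed

section \<open>Induced cycles and the contradiction\<close>

text \<open>The two neighbours of \<open>i\<close> differ by 2 modulo \<open>n\<close>. They are
  distinct, and they could be adjacent only if \<open>n\<close> divided 1 or 3.\<close>

lemma cycle_graph_nonsimplicial:
  assumes "n \<ge> 4" "i < n"
  obtains j k where "j < n" "k < n" "j \<noteq> k" "(i, j) \<in> parcs (cycle_graph n)"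
    "(i, k) \<in> parcs (cycle_graph n)" "(j, k) \<notin> parcs (cycle_graph n)"
proof -
  let ?j = "if Suc i = n then 0 else Suc i" and ?k = "if i = 0 then n - 1 else i - 1"
  have Suc_mod: "Suc m mod n = (if Suc m = n then 0 else Suc m)" if "m < n" for m
    using that by (simp add: mod_Suc)
  have jk: "?j < n" "?k < n" "?j \<noteq> ?k" "?j = Suc i mod n" "i = Suc ?k mod n"
    using assms by (auto simp: Suc_mod)
  show thesis
  proof (rule that[OF jk(1-3)])
    show "(i, ?j) \<in> parcs (cycle_graph n)" "(i, ?k) \<in> parcs (cycle_graph n)"
      using jk assms(2) unfolding cycle_graph_def by simp_all
    have "?k \<noteq> Suc ?j mod n" "?j \<noteq> Suc ?k mod n"
      using assms unfolding Suc_mod[OF jk(1)] Suc_mod[OF jk(2)] by (auto split: if_splits)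
    then show "(?j, ?k) \<notin> parcs (cycle_graph n)"
      unfolding cycle_graph_def by simp
  qed
qed

text \<open>The embeddings of the cycle into \<open>G\<close>, of \<open>G\<close> into its
  extension by isolated vertices, and of that into the competition graph all preserve and reflect
  arcs. Inducedness ensures that non-adjacency survives the first.\<close>

lemma induced_cycle_in_competition_graph:
  fixes G :: "'a pair_pre_digraph"
  assumes "has_induced_cycle G n"
    and "digraph_iso (add_isolated k G) (competition_graph (poc_digraph d S))"
  obtains \<phi> where "inj_on \<phi> {..<n}"
    "\<And>i j. i < n \<Longrightarrow> j < n \<Longrightarrow>
      (\<phi> i, \<phi> j) \<in> parcs (competition_graph (poc_digraph d S)) \<longleftrightarrow> (i, j) \<in> parcs (cycle_graph n)"
proof -
  obtain H :: "'a pair_pre_digraph"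
    where H: "induced_subgraph H G" "digraph_iso (cycle_graph n) H"
    using assms(1) by (auto simp: has_induced_cycle_def)
  obtain c where c: "inj_on c {..<n}" "pverts H = c ` {..<n}"
    "\<And>i j. i < n \<Longrightarrow> j < n \<Longrightarrow> (c i, c j) \<in> parcs H \<longleftrightarrow> (i, j) \<in> parcs (cycle_graph n)"
    using digraph_iso_with_projE[OF H(2)] by (auto simp: cycle_graph_def)
  have sub: "pverts H \<subseteq> pverts G"
    "parcs H = {e \<in> parcs G. fst e \<in> pverts H \<and> snd e \<in> pverts H}"
    using H(1) by (auto simp: induced_subgraph_def subgraph_def)
  obtain f where f: "inj_on f (pverts (add_isolated k G))"
    "\<And>x y. x \<in> pverts (add_isolated k G) \<Longrightarrow> y \<in> pverts (add_isolated k G) \<Longrightarrow>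
      (f x, f y) \<in> parcs (competition_graph (poc_digraph d S)) \<longleftrightarrow>
      (x, y) \<in> parcs (add_isolated k G)"
    using digraph_iso_with_projE[OF assms(2)] by metis
  have c_in: "c i \<in> pverts H" if "i < n" for i
    using c(2) that by blast
  have Inl_in: "Inl (c i) \<in> pverts (add_isolated k G)" if "i < n" for i
    using c_in[OF that] sub(1) by (auto simp: add_isolated_def)
  show thesis
  proof (rule that)
    show "inj_on (\<lambda>i. f (Inl (c i))) {..<n}"
      using c(1) Inl_in by (auto simp: inj_on_def inj_on_eq_iff[OF f(1)])
    fix i j assume ij: "i < n" "j < n"
    have "(Inl (c i), Inl (c j)) \<in> parcs (add_isolated k G) \<longleftrightarrow> (c i, c j) \<in> parcs G"
      by (force simp: add_isolated_def)
    also have "\<dots> \<longleftrightarrow> (c i, c j) \<in> parcs H"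
      using c_in ij sub(2) by auto
    finally show "(f (Inl (c i)), f (Inl (c j))) \<in> parcs (competition_graph (poc_digraph d S))
        \<longleftrightarrow> (i, j) \<in> parcs (cycle_graph n)"
      using f(2) c(3) Inl_in ij by simp
  qed
qed

theorem theorem3p14:
  fixes G :: "'a pair_pre_digraph"
  assumes "pair_graph G"
    and "\<exists>n\<ge>4. has_induced_cycle G n"
  shows "dim_poc G \<ge> 3"
proof (rule ccontr)
  assume "\<not> dim_poc G \<ge> 3"
  then have d: "dim_poc G \<le> 2" by simp
  \<comment> \<open>The value of \<open>LEAST\<close> is attained only if some dimension works,
    hence the explicit representation.\<close>
  obtain k S where iso:
    "digraph_iso (add_isolated k G) (competition_graph (poc_digraph (dim_poc G) S))"
    using LeastI_ex[OF ex_poc_representation[OF assms(1)]] unfolding dim_poc_def by blast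
  let ?A = "parcs (competition_graph (poc_digraph (dim_poc G) S))"
  obtain n where n: "n \<ge> 4" "has_induced_cycle G n" using assms(2) by blast
  obtain \<phi> where \<phi>: "inj_on \<phi> {..<n}"
    "\<And>i j. i < n \<Longrightarrow> j < n \<Longrightarrow> (\<phi> i, \<phi> j) \<in> ?A \<longleftrightarrow> (i, j) \<in> parcs (cycle_graph n)"
    using induced_cycle_in_competition_graph[OF n(2) iso] by blast
  obtain i where i: "i < n" "\<And>j. j < n \<Longrightarrow> \<phi> i 0 \<le> \<phi> j 0"
    using n(1) ex_is_arg_min_if_finite[of "{..<n}" "\<lambda>i. \<phi> i 0"]
    by (fastforce simp: is_arg_min_linorder)
  obtain j k where "j < n" "k < n" "j \<noteq> k" "(i, j) \<in> parcs (cycle_graph n)"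
    "(i, k) \<in> parcs (cycle_graph n)" "(j, k) \<notin> parcs (cycle_graph n)"
    using cycle_graph_nonsimplicial[OF n(1) i(1)] by blast
  moreover from this have "\<phi> j \<noteq> \<phi> k"
    using \<phi>(1) by (auto dest: inj_onD)
  \<comment> \<open>Minimality of \<open>\<phi> i\<close> makes the images of \<open>j\<close> and
    \<open>k\<close> adjacent, although \<open>j\<close> and \<open>k\<close> are not adjacent in
    the cycle.\<close>
  ultimately show False
    using simplicial_if_first_coordinate_minimal[OF d, of "\<phi> i" "\<phi> j" S "\<phi> k"] \<phi>(2) i
    by auto
qed

end
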